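(* Let $K$ be any non-empty compact convex subset of a locally convex real space $\mathcal{X}$ and let $h:K\rightarrow[\mathrm{k},\infty]$ be any extended real-valued function with $\mathrm{k}\in\mathbb{R}$ and $h\not\equiv\infty$. Then, for every $x^{\ast}\in\mathcal{X}^{\ast}$, the Fenchel subdifferential $\partial h^{\ast}(x^{\ast})\subset\mathcal{X}$ of $h^{\ast}$ at the point $x^{\ast}$ is the non-empty compact convex set $$\partial h^{\ast}(x^{\ast})=\overline{\mathrm{co}}\left(\Omega(h-x^{\ast},K)\right).$$
   Context: Topological vector spaces are assumed to be Hausdorff; a locally convex real space is a real, Hausdorff, locally convex topological vector space. $\mathcal{X}^{\ast}$ is the space of continuous linear functionals $\mathcal{X}\to\mathbb{R}$, equipped with the weak$^{\ast}$-topology. The continuous linear functionals on $\mathcal{X}^{\ast}$ are exactly the maps $x^{\ast}\mapsto x^{\ast}(x)$ with $x\in\mathcal{X}$, so the dual of $\mathcal{X}^{\ast}$ is identified with $\mathcal{X}$. The Legendre–Fenchel transform of $h:K\to(-\infty,\infty]$, $h\not\equiv\infty$, is the function $h^{\ast}:\mathcal{X}^{\ast}\to(-\infty,\infty]$, $$h^{\ast}(x^{\ast}):=\sup_{x\in K}\{x^{\ast}(x)-h(x)\}.$$ For a function $f:\mathcal{Z}\to(-\infty,\infty]$ on a real topological vector space $\mathcal{Z}$, a continuous linear functional $\ell\in\mathcal{Z}^{\ast}$ is a Fenchel subgradient of $f$ at $z\in\mathcal{Z}$ iff $f(z+z')\geq f(z)+\ell(z')$ for all $z'\in\mathcal{Z}$;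 the set $\partial f(z)$ of all of them is the Fenchel subdifferential of $f$ at $z$. In particular, $\partial h^{\ast}(x^{\ast})$ is the set of all $x\in\mathcal{X}$ such that $h^{\ast}(x^{\ast}+y^{\ast})\geq h^{\ast}(x^{\ast})+y^{\ast}(x)$ for all $y^{\ast}\in\mathcal{X}^{\ast}$. For $g:K\to(-\infty,\infty]$ define $$\Omega(g,K):=\Big\{x\in K:\ \exists \text{ a net } \{x_i\}_{i\in I}\subset K \text{ with } x_i\to x \text{ and } \lim_I g(x_i)=\inf g(K)\Big\},$$ where $\inf g(K):=\inf_{x\in K}g(x)$. Here $h-x^{\ast}$ is the function $x\mapsto h(x)-x^{\ast}(x)$ on $K$. $\overline{\mathrm{co}}(S)$ denotes the closure (in $\mathcal{X}$) of the convex hull of $S$. *)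

theory Defs
  imports "HOL-Analysis.Analysis"
begin

(* The separation axiom is part of the definition of a topological vector space here. *)

class topological_real_vector = real_vector + topological_ab_group_add + t2_space +
  assumes tendsto_scaleR_Pair:
    "\<And>(c::real) x. LIM p (nhds c \<times>\<^sub>F nhds x). fst p *\<^sub>R snd p :> nhds (c *\<^sub>R x)"

(* The constant convex is not available inside a class specification, so its definition
   is written out; see locally_convex_zero. *)

class locally_convex_real_space = topological_real_vector +
  assumes locally_convex_zero_raw:
    "open U \<Longrightarrow> 0 \<in> U \<Longrightarrow> \<exists>V. open V \<and> 0 \<in> V \<and> V \<subseteq> U \<and>
      (\<forall>x\<in>V. \<forall>y\<in>V. \<forall>u\<ge>0. \<forall>v\<ge>0. u + v = 1 \<longrightarrow> u *\<^sub>R x + v *\<^sub>R y \<in> V)"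

lemma locally_convex_zero:
  fixes U :: "'a::locally_convex_real_space set"
  assumes "open U" "0 \<in> U"
  shows "\<exists>V. open V \<and> 0 \<in> V \<and> convex V \<and> V \<subseteq> U"
  using locally_convex_zero_raw[OF assms] unfolding convex_def by blast

instance real_normed_vector \<subseteq> topological_real_vector
proof
  fix c :: real and x :: 'a
  show "LIM p (nhds c \<times>\<^sub>F nhds x). fst p *\<^sub>R snd p :> nhds (c *\<^sub>R x)"
    by (intro tendsto_scaleR filterlim_fst filterlim_snd)
qed

instance real_normed_vector \<subseteq> locally_convex_real_space
proof
  fix U :: "'a set"
  assume "open U" "0 \<in> U"
  then obtain e where "e > 0" "ball 0 e \<subseteq> U"
    by (meson openE)
  then show "\<exists>V. open V \<and> 0 \<in> V \<and> V \<subseteq> U \<and>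
      (\<forall>x\<in>V. \<forall>y\<in>V. \<forall>u\<ge>0. \<forall>v\<ge>0. u + v = 1 \<longrightarrow> u *\<^sub>R x + v *\<^sub>R y \<in> V)"
    using convex_ball[of "0::'a" e] unfolding convex_def
    by (intro exI[of _ "ball 0 e"]) (simp del: mem_ball)
qed

lemma tendsto_scaleR_tvs:
  fixes g :: "'b \<Rightarrow> 'a::topological_real_vector"
  assumes "(f \<longlongrightarrow> c) F" "(g \<longlongrightarrow> x) F"
  shows "((\<lambda>y. f y *\<^sub>R g y) \<longlongrightarrow> c *\<^sub>R x) F"
  using filterlim_compose[OF tendsto_scaleR_Pair, of "\<lambda>y. (f y, g y)" c x F] assms
  by (simp add: filterlim_Pair)

definition continuous_functionals :: "('z::topological_real_vector \<Rightarrow> real) set" where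
  "continuous_functionals = {l. linear l \<and> continuous_on UNIV l}"

typedef (overloaded) ('a::topological_real_vector) weak_star_dual =
    "continuous_functionals :: ('a \<Rightarrow> real) set"
  morphisms dual_apply Abs_weak_star_dual
proof
  show "(\<lambda>_. 0) \<in> continuous_functionals"
    by (simp add: continuous_functionals_def linear_iff)
qed

setup_lifting type_definition_weak_star_dual

lemma weak_star_dual_eqI: "(\<And>x. dual_apply f x = dual_apply g x) \<Longrightarrow> f = g"
  by (metis dual_apply_inject ext)

instantiation weak_star_dual :: (topological_real_vector) real_vector
begin

lift_definition zero_weak_star_dual :: "'a weak_star_dual" is "\<lambda>_. 0"
  by (simp add: continuous_functionals_def linear_iff)

lift_definition plus_weak_star_dual :: "'a weak_star_dual \<Rightarrow> 'a weak_star_dual \<Rightarrow> 'a weak_star_dual"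
  is "\<lambda>f g x. f x + g x"
  by (auto simp: continuous_functionals_def linear_iff algebra_simps intro!: continuous_intros)

lift_definition minus_weak_star_dual :: "'a weak_star_dual \<Rightarrow> 'a weak_star_dual \<Rightarrow> 'a weak_star_dual"
  is "\<lambda>f g x. f x - g x"
  by (auto simp: continuous_functionals_def linear_iff algebra_simps intro!: continuous_intros)

lift_definition uminus_weak_star_dual :: "'a weak_star_dual \<Rightarrow> 'a weak_star_dual"
  is "\<lambda>f x. - f x"
  by (auto simp: continuous_functionals_def linear_iff algebra_simps intro!: continuous_intros)

lift_definition scaleR_weak_star_dual :: "real \<Rightarrow> 'a weak_star_dual \<Rightarrow> 'a weak_star_dual"
  is "\<lambda>c f x. c * f x"
  by (auto simp: continuous_functionals_def linear_iff algebra_simps intro!: continuous_intros)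

instance
  by standard (transfer; simp add: algebra_simps)+

end

lemma dual_apply_simps [simp]:
  "dual_apply 0 x = 0"
  "dual_apply (f + g) x = dual_apply f x + dual_apply g x"
  "dual_apply (f - g) x = dual_apply f x - dual_apply g x"
  "dual_apply (- f) x = - dual_apply f x"
  "dual_apply (c *\<^sub>R f) x = c * dual_apply f x"
  by (transfer; simp)+

(* The weak-star topology: the coarsest one making every evaluation map continuous. *)

instantiation weak_star_dual :: (topological_real_vector) topological_space
begin

definition open_weak_star_dual :: "'a weak_star_dual set \<Rightarrow> bool" where
  "open_weak_star_dual =
     generate_topology {W. \<exists>x V. open V \<and> W = {f. dual_apply f x \<in> V}}"

instance
  by standard (auto simp: open_weak_star_dual_def intro: generate_topology.intros)

end

lemma tendsto_weak_star_dual_iff: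
  fixes f :: "'b \<Rightarrow> 'a::topological_real_vector weak_star_dual"
  shows "(f \<longlongrightarrow> l) F \<longleftrightarrow> (\<forall>x. ((\<lambda>y. dual_apply (f y) x) \<longlongrightarrow> dual_apply l x) F)"
  (is "?L \<longleftrightarrow> ?R")
proof -
  let ?T = "{W. \<exists>x V. open V \<and> W = {f. dual_apply f x \<in> V}} :: 'a weak_star_dual set set"
  have "nhds l = (INF S\<in>{S\<in>?T. l \<in> S}. principal S)"
    by (rule nhds_generated_topology) (rule open_weak_star_dual_def)
  then have L: "?L \<longleftrightarrow> (\<forall>S\<in>{S\<in>?T. l \<in> S}. \<forall>\<^sub>F y in F. f y \<in> S)"
    by (simp only: filterlim_INF filterlim_principal)
  show ?thesis
    unfolding L
  proof (intro iffI allI ballI topological_tendstoI)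
    fix x and V :: "real set"
    assume "\<forall>S\<in>{S\<in>?T. l \<in> S}. \<forall>\<^sub>F y in F. f y \<in> S" and V: "open V" "dual_apply l x \<in> V"
    moreover have "{g. dual_apply g x \<in> V} \<in> {S\<in>?T. l \<in> S}"
      using V by auto
    ultimately have "\<forall>\<^sub>F y in F. f y \<in> {g. dual_apply g x \<in> V}"
      by (rule_tac bspec)
    then show "\<forall>\<^sub>F y in F. dual_apply (f y) x \<in> V"
      by simp
  next
    fix S
    assume R: "?R" and "S \<in> {S\<in>?T. l \<in> S}"
    then obtain x V where S: "open V" "S = {g. dual_apply g x \<in> V}" "dual_apply l x \<in> V"
      by blast
    have "\<forall>\<^sub>F y in F. dual_apply (f y) x \<in> V"
      using R[rule_format, of x] S(1,3) by (rule topological_tendstoD)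
    then show "\<forall>\<^sub>F y in F. f y \<in> S"
      by (simp add: S(2))
  qed
qed

instance weak_star_dual :: (topological_real_vector) topological_real_vector
proof
  fix f g :: "'a weak_star_dual" and c :: real
  have eval: "((\<lambda>y. dual_apply (u y) x) \<longlongrightarrow> dual_apply l x) F"
    if "LIM y F. u y :> nhds l" for u F x and l :: "'a weak_star_dual"
    using that by (simp only: tendsto_weak_star_dual_iff)
  show "LIM p (nhds f \<times>\<^sub>F nhds g). fst p + snd p :> nhds (f + g)"
    unfolding tendsto_weak_star_dual_iff dual_apply_simps
    by (intro allI tendsto_add eval filterlim_fst filterlim_snd)
  show "(uminus \<longlongrightarrow> - f) (nhds f)"
    unfolding tendsto_weak_star_dual_iff dual_apply_simps
    by (intro allI tendsto_minus eval filterlim_ident)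
  show "LIM p (nhds c \<times>\<^sub>F nhds f). fst p *\<^sub>R snd p :> nhds (c *\<^sub>R f)"
    unfolding tendsto_weak_star_dual_iff dual_apply_simps
    by (intro allI tendsto_mult eval filterlim_fst filterlim_snd)
  assume "f \<noteq> g"
  then obtain x where "dual_apply f x \<noteq> dual_apply g x"
    using weak_star_dual_eqI by blast
  then obtain U V where UV: "open U" "open V" "dual_apply f x \<in> U" "dual_apply g x \<in> V" "U \<inter> V = {}"
    by (meson hausdorff)
  have "open {f. dual_apply f x \<in> U}" "open {f. dual_apply f x \<in> V}"
    unfolding open_weak_star_dual_def using UV by (blast intro: generate_topology.Basis)+
  with UV show "\<exists>U V. open U \<and> open V \<and> f \<in> U \<and> g \<in> V \<and> U \<inter> V = {}"
    by (intro exI[of _ "{f. dual_apply f x \<in> U}"] exI[of _ "{f. dual_apply f x \<in> V}"]) auto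
qed

definition legendre_fenchel ::
    "'a::topological_real_vector set \<Rightarrow> ('a \<Rightarrow> ereal) \<Rightarrow> 'a weak_star_dual \<Rightarrow> ereal" where
  "legendre_fenchel K h f = (SUP x\<in>K. ereal (dual_apply f x) - h x)"

definition fenchel_subdifferential ::
    "('z::topological_real_vector \<Rightarrow> ereal) \<Rightarrow> 'z \<Rightarrow> ('z \<Rightarrow> real) set" where
  "fenchel_subdifferential F z =
     {l \<in> continuous_functionals. \<forall>z'. F (z + z') \<ge> F z + ereal (l z')}"

(* The dual of the weak-star dual is identified with the space itself, a point x
   corresponding to the evaluation map at x. *)

definition predual_subdifferential ::
    "('a::topological_real_vector weak_star_dual \<Rightarrow> ereal) \<Rightarrow> 'a weak_star_dual \<Rightarrow> 'a set" where
  "predual_subdifferential F f =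
     {x. (\<lambda>f'. dual_apply f' x) \<in> fenchel_subdifferential F f}"

lemma evaluation_in_continuous_functionals:
  "(\<lambda>f. dual_apply f x) \<in> continuous_functionals"
proof -
  have "continuous_on UNIV (\<lambda>f. dual_apply f x)"
    unfolding continuous_on_def
    by (intro ballI tendsto_weak_star_dual_iff[THEN iffD1, rule_format] tendsto_ident_at)
  then show ?thesis
    by (simp add: continuous_functionals_def linear_iff)
qed

lemma mem_predual_subdifferential_iff:
  "x \<in> predual_subdifferential F f \<longleftrightarrow> (\<forall>f'. F (f + f') \<ge> F f + ereal (dual_apply f' x))"
  by (simp add: predual_subdifferential_def fenchel_subdifferential_def
      evaluation_in_continuous_functionals)

definition directed_set :: "'i set \<Rightarrow> ('i \<Rightarrow> 'i \<Rightarrow> bool) \<Rightarrow> bool" where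
  "directed_set I r \<longleftrightarrow> I \<noteq> {} \<and> (\<forall>i\<in>I. r i i) \<and>
     (\<forall>i\<in>I. \<forall>j\<in>I. \<forall>k\<in>I. r i j \<longrightarrow> r j k \<longrightarrow> r i k) \<and>
     (\<forall>i\<in>I. \<forall>j\<in>I. \<exists>k\<in>I. r i k \<and> r j k)"

definition net_filter :: "'i set \<Rightarrow> ('i \<Rightarrow> 'i \<Rightarrow> bool) \<Rightarrow> 'i filter" where
  "net_filter I r = (INF i\<in>I. principal {j\<in>I. r i j})"

lemma eventually_net_filter:
  assumes "directed_set I r"
  shows "eventually P (net_filter I r) \<longleftrightarrow> (\<exists>i\<in>I. \<forall>j\<in>I. r i j \<longrightarrow> P j)"
proof -
  have "eventually P (net_filter I r) \<longleftrightarrow> (\<exists>i\<in>I. eventually P (principal {j\<in>I. r i j}))"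
    unfolding net_filter_def
  proof (rule eventually_INF_base)
    show "I \<noteq> {}"
      using assms by (simp add: directed_set_def)
    fix a b
    assume ab: "a \<in> I" "b \<in> I"
    then obtain k where k: "k \<in> I" "r a k" "r b k"
      using assms unfolding directed_set_def by meson
    have "{j\<in>I. r k j} \<subseteq> {j\<in>I. r a j} \<inter> {j\<in>I. r b j}"
      using assms ab k unfolding directed_set_def by blast
    then show "\<exists>x\<in>I. principal {j\<in>I. r x j} \<le> inf (principal {j\<in>I. r a j}) (principal {j\<in>I. r b j})"
      using k by auto
  qed
  then show ?thesis
    by (auto simp: eventually_principal)
qed

(* HOL cannot quantify over the type of the index set inside a definition. The index
   type used here loses no generality: see generalized_minimizersI. *)

definition generalized_minimizers ::
    "('a::topological_space \<Rightarrow> ereal) \<Rightarrow> 'a set \<Rightarrow> 'a set" where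
  "generalized_minimizers g K =
     {x\<in>K. \<exists>(I :: ('a set \<times> ereal set) set) r \<xi>. directed_set I r \<and> \<xi> ` I \<subseteq> K \<and>
        (\<xi> \<longlongrightarrow> x) (net_filter I r) \<and>
        ((\<lambda>i. g (\<xi> i)) \<longlongrightarrow> (INF y\<in>K. g y)) (net_filter I r)}"

lemma generalized_minimizersI:
  fixes J :: "'i set" and \<eta> :: "'i \<Rightarrow> 'a::topological_space"
  assumes J: "directed_set J s" and K: "x \<in> K" "\<eta> ` J \<subseteq> K"
    and \<eta>: "(\<eta> \<longlongrightarrow> x) (net_filter J s)"
    and g: "((\<lambda>j. g (\<eta> j)) \<longlongrightarrow> (INF y\<in>K. g y)) (net_filter J s)"
  shows "x \<in> generalized_minimizers g K"
proof -
  define m where "m = (INF y\<in>K. g y)"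
  define I where "I = {(U, V). open U \<and> x \<in> U \<and> open V \<and> m \<in> V}"
  define r :: "'a set \<times> ereal set \<Rightarrow> 'a set \<times> ereal set \<Rightarrow> bool"
    where "r p q \<longleftrightarrow> fst q \<subseteq> fst p \<and> snd q \<subseteq> snd p" for p q
  have "\<exists>y\<in>K. y \<in> fst p \<and> g y \<in> snd p" if "p \<in> I" for p
  proof -
    have "\<forall>\<^sub>F j in net_filter J s. \<eta> j \<in> fst p" "\<forall>\<^sub>F j in net_filter J s. g (\<eta> j) \<in> snd p"
      using that \<eta> g by (auto simp: I_def m_def tendsto_def)
    then have "\<forall>\<^sub>F j in net_filter J s. \<eta> j \<in> fst p \<and> g (\<eta> j) \<in> snd p"
      by (rule eventually_conj)
    then obtain j where "j \<in> J" "\<forall>k\<in>J. s j k \<longrightarrow> \<eta> k \<in> fst p \<and> g (\<eta> k) \<in> snd p"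
      by (auto simp: eventually_net_filter[OF J])
    moreover have "s j j"
      using J \<open>j \<in> J\<close> by (simp add: directed_set_def)
    ultimately show ?thesis
      using K by blast
  qed
  then obtain \<xi> where \<xi>: "\<And>p. p \<in> I \<Longrightarrow> \<xi> p \<in> K \<and> \<xi> p \<in> fst p \<and> g (\<xi> p) \<in> snd p"
    by metis
  have I: "directed_set I r"
    unfolding directed_set_def
  proof (intro conjI ballI impI)
    show "I \<noteq> {}"
      unfolding I_def by (auto intro!: exI[of _ UNIV])
    fix p q
    assume "p \<in> I" "q \<in> I"
    then show "\<exists>k\<in>I. r p k \<and> r q k"
      by (intro bexI[of _ "(fst p \<inter> fst q, snd p \<inter> snd q)"]) (auto simp: I_def r_def)
  qed (auto simp: r_def)
  have "(\<xi> \<longlongrightarrow> x) (net_filter I r)"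
    unfolding tendsto_def eventually_net_filter[OF I]
  proof (intro allI impI)
    fix U assume "open U" "x \<in> U"
    then show "\<exists>i\<in>I. \<forall>j\<in>I. r i j \<longrightarrow> \<xi> j \<in> U"
      using \<xi> by (intro bexI[of _ "(U, UNIV)"]) (force simp: I_def r_def)+
  qed
  moreover have "((\<lambda>i. g (\<xi> i)) \<longlongrightarrow> m) (net_filter I r)"
    unfolding tendsto_def eventually_net_filter[OF I]
  proof (intro allI impI)
    fix V assume "open V" "m \<in> V"
    then show "\<exists>i\<in>I. \<forall>j\<in>I. r i j \<longrightarrow> g (\<xi> j) \<in> V"
      using \<xi> by (intro bexI[of _ "(UNIV, V)"]) (force simp: I_def r_def)+
  qed
  moreover have "\<xi> ` I \<subseteq> K"
    using \<xi> by blast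
  ultimately show ?thesis
    unfolding generalized_minimizers_def mem_Collect_eq m_def using K(1) I by blast
qed

end

theory Submission
  imports Defs
begin

text \<open>With \<open>g = h - x\<^sup>*\<close> and \<open>m = inf g(K)\<close>, a point \<open>x\<close> is a subgradient iff
  \<open>u(x) - m \<le> sup\<^sub>K (u - g)\<close> for every continuous linear \<open>u\<close>. This is an intersection of closed
  half-spaces that contains every generalized minimizer, hence their closed convex hull.
  Conversely, a point \<open>x\<close> outside the hull is separated from it by some \<open>u\<close>; by compactness a whole
  sublevel set \<open>{g < m + e}\<close> lies where \<open>u < s' < u(x)\<close>, so for small \<open>t > 0\<close> the function
  \<open>t u - g\<close> stays below \<open>t s' - m < t u(x) - m\<close> on \<open>K\<close>, and \<open>x\<close> is not a subgradient.

  The separation theorem rests on the Hahn-Banach theorem, proved without extending functionals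
  from subspaces: by Zorn's lemma there is a minimal sublinear functional below a given one, and
  minimality forces it to be linear.\<close>

section \<open>Sublinear functionals and the Hahn-Banach theorem\<close>

text \<open>Homogeneity is demanded only as an inequality: applying it to \<open>1 / t\<close> as
  well gives equality, so each instance has just one direction to check.\<close>

definition sublinear :: "('a::real_vector \<Rightarrow> real) \<Rightarrow> bool" where
  "sublinear p \<longleftrightarrow> (\<forall>x y. p (x + y) \<le> p x + p y) \<and> (\<forall>t>0. \<forall>x. p (t *\<^sub>R x) \<le> t * p x)"

lemma sublinear_add: "sublinear p \<Longrightarrow> p (x + y) \<le> p x + p y"
  by (simp add: sublinear_def)

lemma sublinear_scale:
  assumes "sublinear p" "t > 0"
  shows "p (t *\<^sub>R x) = t * p x"
proof (rule antisym)
  show "p (t *\<^sub>R x) \<le> t * p x"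
    using assms by (simp add: sublinear_def)
  have "p ((1 / t) *\<^sub>R (t *\<^sub>R x)) \<le> (1 / t) * p (t *\<^sub>R x)"
    using assms unfolding sublinear_def by (meson zero_less_divide_1_iff)
  then show "t * p x \<le> p (t *\<^sub>R x)"
    using assms(2) by (simp add: field_simps)
qed

lemma sublinear_zero: "sublinear p \<Longrightarrow> p 0 = 0"
  using sublinear_scale[of p 2 0] by simp

lemma sublinear_minus: "sublinear p \<Longrightarrow> - p (- x) \<le> p x"
  using sublinear_add[of p x "- x"] sublinear_zero[of p] by simp

text \<open>For sublinear \<open>p\<close> this is the largest sublinear functional below
  \<open>p\<close> whose value at \<open>- y\<close> is at most \<open>- p y\<close>.\<close>

definition sublinear_tilt :: "('a::real_vector \<Rightarrow> real) \<Rightarrow> 'a \<Rightarrow> 'a \<Rightarrow> real" where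
  "sublinear_tilt p y x = (INF t\<in>{0..}. p (x + t *\<^sub>R y) - t * p y)"

text \<open>A real infimum is a lower bound only of a family that is bounded below. Here
  subadditivity for \<open>x + s *\<^sub>R y\<close> and \<open>- x\<close> gives the bound
  \<open>- p (- x)\<close>, uniform in \<open>s\<close>.\<close>

lemma sublinear_tilt_le:
  assumes "sublinear p" "t \<ge> 0"
  shows "sublinear_tilt p y x \<le> p (x + t *\<^sub>R y) - t * p y"
  unfolding sublinear_tilt_def
proof (rule cINF_lower)
  have "- p (- x) \<le> p (x + s *\<^sub>R y) - s * p y" if "s \<ge> 0" for s
  proof -
    have "p (s *\<^sub>R y) = s * p y"
      using sublinear_scale[OF assms(1), of s y] sublinear_zero[OF assms(1)] that
      by (cases "s = 0") auto
    then show ?thesis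
      using sublinear_add[OF assms(1), of "x + s *\<^sub>R y" "- x"] by simp
  qed
  then show "bdd_below ((\<lambda>t. p (x + t *\<^sub>R y) - t * p y) ` {0..})"
    by (auto intro!: bdd_belowI2)
qed (use assms in simp)

lemma le_sublinear_tilt:
  assumes "\<And>t. t \<ge> 0 \<Longrightarrow> c \<le> p (x + t *\<^sub>R y) - t * p y"
  shows "c \<le> sublinear_tilt p y x"
  unfolding sublinear_tilt_def using assms by (intro cINF_greatest) auto

lemma sublinear_tilt_le_self: "sublinear p \<Longrightarrow> sublinear_tilt p y x \<le> p x"
  using sublinear_tilt_le[of p 0 y x] by simp

text \<open>Parameters \<open>s\<close> for \<open>u\<close> and \<open>t\<close> for
  \<open>v\<close> combine to the parameter \<open>s + t\<close> for \<open>u + v\<close>; the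
  infimum is taken over \<open>s\<close> first and then over \<open>t\<close>. Scaling by
  \<open>c\<close> turns \<open>t\<close> into \<open>c * t\<close>.\<close>

lemma sublinear_sublinear_tilt:
  assumes p: "sublinear p"
  shows "sublinear (sublinear_tilt p y)"
  unfolding sublinear_def
proof (intro conjI allI impI)
  fix u v
  have "sublinear_tilt p y (u + v) - (p (v + t *\<^sub>R y) - t * p y) \<le> sublinear_tilt p y u"
    if "t \<ge> 0" for t
  proof (rule le_sublinear_tilt)
    fix s :: real assume "s \<ge> 0"
    have "sublinear_tilt p y (u + v) \<le> p ((u + v) + (s + t) *\<^sub>R y) - (s + t) * p y"
      by (rule sublinear_tilt_le) (use p \<open>s \<ge> 0\<close> that in auto)
    also have "(u + v) + (s + t) *\<^sub>R y = (u + s *\<^sub>R y) + (v + t *\<^sub>R y)"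
      by (simp add: algebra_simps)
    also have "p \<dots> \<le> p (u + s *\<^sub>R y) + p (v + t *\<^sub>R y)"
      by (rule sublinear_add[OF p])
    finally show "sublinear_tilt p y (u + v) - (p (v + t *\<^sub>R y) - t * p y)
        \<le> p (u + s *\<^sub>R y) - s * p y"
      by (simp add: algebra_simps)
  qed
  then have "sublinear_tilt p y (u + v) - sublinear_tilt p y u \<le> sublinear_tilt p y v"
    by (intro le_sublinear_tilt) (smt (verit))
  then show "sublinear_tilt p y (u + v) \<le> sublinear_tilt p y u + sublinear_tilt p y v"
    by simp
next
  fix c :: real and u assume "c > 0"
  have "sublinear_tilt p y (c *\<^sub>R u) / c \<le> sublinear_tilt p y u"
  proof (rule le_sublinear_tilt)
    fix t :: real assume "t \<ge> 0"
    have "sublinear_tilt p y (c *\<^sub>R u) \<le> p (c *\<^sub>R u + (c * t) *\<^sub>R y) - (c * t) * p y"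
      by (rule sublinear_tilt_le) (use p \<open>c > 0\<close> \<open>t \<ge> 0\<close> in auto)
    also have "p (c *\<^sub>R u + (c * t) *\<^sub>R y) = c * p (u + t *\<^sub>R y)"
      using sublinear_scale[OF p \<open>c > 0\<close>, of "u + t *\<^sub>R y"] by (simp add: scaleR_add_right)
    finally show "sublinear_tilt p y (c *\<^sub>R u) / c \<le> p (u + t *\<^sub>R y) - t * p y"
      using \<open>c > 0\<close> by (simp add: field_simps)
  qed
  then show "sublinear_tilt p y (c *\<^sub>R u) \<le> c * sublinear_tilt p y u"
    using \<open>c > 0\<close> by (simp add: field_simps)
qed

text \<open>Each tilt of \<open>q\<close> is sublinear and below \<open>q\<close>, hence equal to
  \<open>q\<close>. The bound on the tilt at parameter 1 then reads as superadditivity.\<close>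

lemma linear_if_minimal_sublinear:
  assumes q: "sublinear q" and min: "\<And>r. sublinear r \<Longrightarrow> r \<le> q \<Longrightarrow> r = q"
  shows "linear q"
proof -
  have add: "q (x + y) = q x + q y" for x y
  proof (rule antisym)
    have "sublinear_tilt q y = q"
      by (intro min sublinear_sublinear_tilt le_funI sublinear_tilt_le_self q)
    then show "q x + q y \<le> q (x + y)"
      using sublinear_tilt_le[OF q, of 1 y x] by simp
  qed (rule sublinear_add[OF q])
  have minus: "q (- x) = - q x" for x
    using add[of x "- x"] sublinear_zero[OF q] by simp
  have "q (c *\<^sub>R x) = c * q x" for c x
    using sublinear_scale[OF q, of c x] sublinear_scale[OF q, of "- c" x] minus[of "c *\<^sub>R x"]
      sublinear_zero[OF q]
    by (cases c "0 :: real" rule: linorder_cases) auto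
  with add show ?thesis
    by (simp add: linear_iff)
qed

text \<open>The infimum is finite because every member is at least \<open>- p (- x)\<close> at
  \<open>x\<close>. For subadditivity, two members \<open>q\<close> and \<open>r\<close> are
  replaced by the smaller one, which bounds both terms at once.\<close>

lemma sublinear_INF_chain:
  fixes C :: "('a::real_vector \<Rightarrow> real) set"
  assumes "C \<noteq> {}" and sub: "\<And>q. q \<in> C \<Longrightarrow> sublinear q \<and> q \<le> p"
    and chain: "\<And>q r. q \<in> C \<Longrightarrow> r \<in> C \<Longrightarrow> q \<le> r \<or> r \<le> q"
  shows "sublinear (\<lambda>x. INF q\<in>C. q x)" and "q \<in> C \<Longrightarrow> (\<lambda>x. INF q\<in>C. q x) \<le> q"
proof -
  have lower: "(INF q\<in>C. q x) \<le> q x" if "q \<in> C" for q x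
  proof (rule cINF_lower[OF _ that])
    have "- p (- x) \<le> r x" if "r \<in> C" for r
      using sub[OF that] sublinear_minus[of r x] by (meson le_funD neg_le_iff_le order_trans)
    then show "bdd_below ((\<lambda>q. q x) ` C)"
      by (rule bdd_belowI2)
  qed
  then show "q \<in> C \<Longrightarrow> (\<lambda>x. INF q\<in>C. q x) \<le> q"
    by (simp add: le_fun_def)
  show "sublinear (\<lambda>x. INF q\<in>C. q x)"
    unfolding sublinear_def
  proof (intro conjI allI impI)
    fix x y
    have "(INF q\<in>C. q (x + y)) \<le> q x + r y" if "q \<in> C" "r \<in> C" for q r
    proof -
      obtain s where "s \<in> C" "s \<le> q" "s \<le> r"
        using chain[of q r] \<open>q \<in> C\<close> \<open>r \<in> C\<close> by blast
      then show ?thesis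
        using lower[of s "x + y"] sub[of s] sublinear_add[of s x y]
        by (smt (verit) le_funD)
    qed
    then have "(INF q\<in>C. q (x + y)) - r y \<le> (INF q\<in>C. q x)" if "r \<in> C" for r
      using that assms(1) by (intro cINF_greatest) (auto simp: algebra_simps)
    then have "(INF q\<in>C. q (x + y)) - (INF q\<in>C. q x) \<le> (INF q\<in>C. q y)"
      using assms(1) by (intro cINF_greatest) (auto simp: algebra_simps)
    then show "(INF q\<in>C. q (x + y)) \<le> (INF q\<in>C. q x) + (INF q\<in>C. q y)"
      by simp
  next
    fix t :: real and x assume "t > 0"
    have "(INF q\<in>C. q (t *\<^sub>R x)) / t \<le> (INF q\<in>C. q x)"
    proof (rule cINF_greatest[OF assms(1)])
      fix q assume "q \<in> C"
      then show "(INF q\<in>C. q (t *\<^sub>R x)) / t \<le> q x"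
        using lower[of q "t *\<^sub>R x"] sublinear_scale[of q t x] sub[of q] \<open>t > 0\<close>
        by (simp add: field_simps)
    qed
    then show "(INF q\<in>C. q (t *\<^sub>R x)) \<le> t * (INF q\<in>C. q x)"
      using \<open>t > 0\<close> by (simp add: field_simps)
  qed
qed

lemma linear_below_sublinear:
  assumes p: "sublinear p"
  obtains f where "linear f" "f \<le> p"
proof -
  define A where "A = {q. sublinear q \<and> q \<le> p}"
  have "\<exists>m\<in>A. \<forall>q\<in>A. q \<le> m \<longrightarrow> q = m"
  proof (rule predicate_Zorn)
    \<comment> \<open>The order is reversed, so that the maximal element supplied by Zorn's lemma is
      a minimal functional.\<close>
    show "partial_order_on A (relation_of (\<lambda>q r. r \<le> q) A)"
      by (rule partial_order_on_relation_ofI) auto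
    fix C assume C: "C \<in> Chains (relation_of (\<lambda>q r. r \<le> q) A)"
    show "\<exists>u\<in>A. \<forall>q\<in>C. u \<le> q"
    proof (cases "C = {}")
      case True
      then show ?thesis
        using p by (auto simp: A_def)
    next
      case False
      have "\<And>q. q \<in> C \<Longrightarrow> sublinear q \<and> q \<le> p"
        "\<And>q r. q \<in> C \<Longrightarrow> r \<in> C \<Longrightarrow> q \<le> r \<or> r \<le> q"
        using C by (auto simp: Chains_def relation_of_def A_def)
      note INF = sublinear_INF_chain[OF False this]
      have "(\<lambda>x. INF q\<in>C. q x) \<le> p"
        using False INF(2) C by (force simp: Chains_def relation_of_def A_def intro: order_trans)
      with INF show ?thesis
        by (intro bexI[of _ "\<lambda>x. INF q\<in>C. q x"]) (auto simp: A_def)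
    qed
  qed
  then obtain m where m: "m \<in> A" "\<And>q. q \<in> A \<Longrightarrow> q \<le> m \<Longrightarrow> q = m"
    by blast
  have "linear m"
    using m by (intro linear_if_minimal_sublinear) (auto simp: A_def)
  with m(1) show thesis
    by (intro that[of m]) (auto simp: A_def)
qed

text \<open>Every linear functional below the tilt of \<open>p\<close> in direction \<open>x\<close> agrees with \<open>p\<close> at \<open>x\<close>,
  because the tilt is at most \<open>- p x\<close> at \<open>- x\<close>.\<close>

theorem Hahn_Banach_sublinear:
  assumes p: "sublinear p"
  obtains f where "linear f" "f \<le> p" "f x = p x"
proof -
  obtain f where f: "linear f" "f \<le> sublinear_tilt p x"
    using linear_below_sublinear[OF sublinear_sublinear_tilt[OF p]] .
  have le: "f \<le> p"
    using f(2) sublinear_tilt_le_self[OF p] by (meson le_fun_def order_trans)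
  have "f (- x) \<le> sublinear_tilt p x (- x)"
    using f(2) by (rule le_funD)
  also have "\<dots> \<le> - p x"
    using sublinear_tilt_le[OF p, of 1 x "- x"] sublinear_zero[OF p] by simp
  finally have "f x = p x"
    using le_funD[OF le, of x] by (simp add: linear_neg[OF f(1)])
  with f(1) le show thesis
    by (rule that)
qed

section \<open>Gauges of convex absorbing sets\<close>

text \<open>The infimum is meaningful only where some \<open>t\<close> is admissible, hence the
  absorption hypotheses below.\<close>

definition minkowski_functional :: "'a::real_vector set \<Rightarrow> 'a \<Rightarrow> real" where
  "minkowski_functional D x = Inf {t. t > 0 \<and> (1 / t) *\<^sub>R x \<in> D}"

lemma minkowski_functional_le: "t > 0 \<Longrightarrow> (1 / t) *\<^sub>R x \<in> D \<Longrightarrow> minkowski_functional D x \<le> t"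
  unfolding minkowski_functional_def by (rule cInf_lower) (auto intro!: bdd_belowI[of _ 0])

lemma le_minkowski_functional:
  assumes "\<exists>t>0. (1 / t) *\<^sub>R x \<in> D" "\<And>t. t > 0 \<Longrightarrow> (1 / t) *\<^sub>R x \<in> D \<Longrightarrow> c \<le> t"
  shows "c \<le> minkowski_functional D x"
  unfolding minkowski_functional_def using assms by (intro cInf_greatest) auto

text \<open>If \<open>x / s\<close> and \<open>y / t\<close> lie in \<open>D\<close>, then
  \<open>(x + y) / (s + t)\<close> is their convex combination with weights
  \<open>s / (s + t)\<close> and \<open>t / (s + t)\<close>.\<close>

lemma sublinear_minkowski_functional:
  assumes D: "convex D" and absorbing: "\<And>x. \<exists>t>0. (1 / t) *\<^sub>R x \<in> D"
  shows "sublinear (minkowski_functional D)"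
  unfolding sublinear_def
proof (intro conjI allI impI)
  fix x y
  have "minkowski_functional D (x + y) \<le> s + t"
    if "s > 0" "t > 0" "(1 / s) *\<^sub>R x \<in> D" "(1 / t) *\<^sub>R y \<in> D" for s t
  proof (rule minkowski_functional_le)
    have "(s / (s + t)) *\<^sub>R ((1 / s) *\<^sub>R x) + (t / (s + t)) *\<^sub>R ((1 / t) *\<^sub>R y) \<in> D"
      using that by (intro convexD[OF D]) (auto simp: add_divide_distrib[symmetric])
    then show "(1 / (s + t)) *\<^sub>R (x + y) \<in> D"
      using that by (simp add: scaleR_add_right)
  qed (use that in simp)
  then have "minkowski_functional D (x + y) - t \<le> minkowski_functional D x" if "t > 0" "(1 / t) *\<^sub>R y \<in> D" for t
    using that by (intro le_minkowski_functional absorbing) (smt (verit))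
  then have "minkowski_functional D (x + y) - minkowski_functional D x \<le> minkowski_functional D y"
    by (intro le_minkowski_functional absorbing) (smt (verit))
  then show "minkowski_functional D (x + y) \<le> minkowski_functional D x + minkowski_functional D y"
    by simp
next
  fix c :: real and x assume "c > 0"
  have "minkowski_functional D (c *\<^sub>R x) / c \<le> minkowski_functional D x"
  proof (intro le_minkowski_functional absorbing)
    fix t :: real assume "t > 0" "(1 / t) *\<^sub>R x \<in> D"
    then have "minkowski_functional D (c *\<^sub>R x) \<le> c * t"
      using \<open>c > 0\<close> by (intro minkowski_functional_le) auto
    then show "minkowski_functional D (c *\<^sub>R x) / c \<le> t"
      using \<open>c > 0\<close> by (simp add: field_simps)
  qed
  then show "minkowski_functional D (c *\<^sub>R x) \<le> c * minkowski_functional D x"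
    using \<open>c > 0\<close> by (simp add: field_simps)
qed

text \<open>An admissible \<open>t < 1\<close> would make \<open>x\<close> a convex combination of
  \<open>x / t\<close> and 0, both in \<open>D\<close>.\<close>

lemma one_le_minkowski_functional:
  assumes "convex D" "0 \<in> D" "x \<notin> D" "\<exists>t>0. (1 / t) *\<^sub>R x \<in> D"
  shows "1 \<le> minkowski_functional D x"
proof (rule le_minkowski_functional)
  fix t :: real assume t: "t > 0" "(1 / t) *\<^sub>R x \<in> D"
  show "1 \<le> t"
  proof (rule ccontr)
    assume "\<not> 1 \<le> t"
    then have "t *\<^sub>R ((1 / t) *\<^sub>R x) + (1 - t) *\<^sub>R 0 \<in> D"
      using t assms by (intro convexD) auto
    then show False
      using t assms by simp
  qed
qed (rule assms)

section \<open>Neighbourhoods of zero and separation of a point from a convex set\<close>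

lemma tvs_open_absorbing:
  fixes U :: "'a::topological_real_vector set"
  assumes "open U" "0 \<in> U"
  shows "\<exists>t>0. t *\<^sub>R x \<in> U"
proof -
  have "((\<lambda>t::real. t *\<^sub>R x) \<longlongrightarrow> 0 *\<^sub>R x) (at_right 0)"
    by (intro tendsto_scaleR_tvs tendsto_intros)
  then have "\<forall>\<^sub>F t in at_right 0. t *\<^sub>R x \<in> U"
    using assms by (auto dest: topological_tendstoD)
  then have "\<forall>\<^sub>F t in at_right (0::real). t > 0 \<and> t *\<^sub>R x \<in> U"
    by (intro eventually_conj eventually_at_right_less)
  then show ?thesis
    using eventually_happens'[OF trivial_limit_at_right_real] by blast
qed

lemma tvs_open_scaleR:
  fixes U :: "'a::topological_real_vector set"
  assumes "open U" "c \<noteq> 0"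
  shows "open ((*\<^sub>R) c ` U)"
proof -
  have "(*\<^sub>R) c ` U = (*\<^sub>R) (1 / c) -` U"
    using assms(2) by (force simp: image_iff)
  moreover have "continuous_on UNIV ((*\<^sub>R) (1 / c) :: 'a \<Rightarrow> 'a)"
    unfolding continuous_on_def by (intro ballI tendsto_scaleR_tvs tendsto_intros)
  ultimately show ?thesis
    using assms(1) by (simp add: open_vimage)
qed

lemma tvs_open_translation:
  fixes U :: "'a::topological_real_vector set"
  assumes "open U"
  shows "open ((+) a ` U)"
proof -
  have "(+) a ` U = (\<lambda>x. x - a) -` U"
    by (force simp: image_iff)
  then show ?thesis
    using assms by (simp add: open_vimage continuous_intros)
qed

lemma linear_continuous_if_bounded_nhds:
  fixes f :: "'a::topological_real_vector \<Rightarrow> real"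
  assumes f: "linear f" and U: "open U" "0 \<in> U" "\<And>u. u \<in> U \<Longrightarrow> \<bar>f u\<bar> \<le> 1"
  shows "continuous_on UNIV f"
  unfolding continuous_on_def
proof (intro ballI tendstoI)
  fix x :: 'a and e :: real assume "e > 0"
  \<comment> \<open>The factor \<open>e / 2\<close> turns the bound 1 on \<open>U\<close> into a
    variation of at most \<open>e / 2\<close>, strictly less than \<open>e\<close>.\<close>
  define W where "W = (+) x ` ((*\<^sub>R) (e / 2) ` U)"
  have "open W" "x \<in> W"
    unfolding W_def using U \<open>e > 0\<close>
    by (auto simp: image_iff intro!: tvs_open_translation tvs_open_scaleR bexI[of _ 0])
  moreover have "dist (f y) (f x) < e" if "y \<in> W" for y
  proof -
    obtain u where u: "u \<in> U" "y = x + (e / 2) *\<^sub>R u"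
      using \<open>y \<in> W\<close> unfolding W_def by blast
    have "\<bar>(e / 2) * f u\<bar> \<le> (e / 2) * 1"
      unfolding abs_mult using U(3)[OF u(1)] \<open>e > 0\<close> by (intro mult_mono) auto
    then show ?thesis
      using \<open>e > 0\<close> u(2) by (simp add: dist_real_def linear_add[OF f] linear_scale[OF f])
  qed
  ultimately show "\<forall>\<^sub>F y in at x within UNIV. dist (f y) (f x) < e"
    by (auto simp: eventually_at_topological)
qed

text \<open>Fatten the translate \<open>S - c0\<close> by a convex neighbourhood \<open>U\<close> of
  0 so small that the result \<open>D\<close> still misses \<open>x - c0\<close>. A linear
  functional below the gauge of \<open>D\<close> that touches it at \<open>x - c0\<close> is at most
  1 on \<open>D\<close> and at least 1 at \<open>x - c0\<close>.\<close>

theorem Hahn_Banach_separation: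
  fixes S :: "'a::locally_convex_real_space set"
  assumes S: "convex S" and x: "x \<notin> closure S"
  obtains f s where "f \<in> continuous_functionals" "s < f x" "\<And>c. c \<in> S \<Longrightarrow> f c \<le> s"
proof (cases "S = {}")
  case True
  then show thesis
    by (intro that[of "\<lambda>_. 0" "-1"]) (auto simp: continuous_functionals_def linear_iff)
next
  case False
  then obtain c0 where c0: "c0 \<in> S"
    by blast
  define N where "N = (\<lambda>u. x - u) -` (- closure S)"
  have "open N" "0 \<in> N"
    unfolding N_def using x by (auto intro!: open_vimage continuous_intros)
  then obtain U where U: "open U" "0 \<in> U" "convex U" "U \<subseteq> N"
    using locally_convex_zero by blast
  define D where "D = (\<Union>c\<in>S. \<Union>u\<in>U. {(c - c0) + u})"
  have D_eq: "D = (\<Union>a\<in>(\<lambda>c. c - c0) ` S. \<Union>u\<in>U. {a + u})"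
    by (auto simp: D_def)
  have "convex D"
    unfolding D_eq using convex_translation_subtract[OF S] U(3) by (intro convex_sums) auto
  have UD: "U \<subseteq> D"
    using c0 by (force simp: D_def)
  have absorbing: "\<exists>t>0. (1 / t) *\<^sub>R y \<in> D" for y
  proof -
    obtain t :: real where "t > 0" "t *\<^sub>R y \<in> U"
      using tvs_open_absorbing[OF U(1,2)] by blast
    with UD show ?thesis
      by (intro exI[of _ "1 / t"]) auto
  qed
  have notin: "x - c0 \<notin> D"
  proof
    assume "x - c0 \<in> D"
    then obtain c u where cu: "c \<in> S" "u \<in> U" "x - c0 = (c - c0) + u"
      by (auto simp: D_def)
    then have "x - u = c"
      by (simp add: algebra_simps)
    then have "x - u \<in> closure S"
      using cu(1) closure_subset by auto
    then show False
      using cu(2) U(4) by (auto simp: N_def)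
  qed
  obtain f where f: "linear f" "f \<le> minkowski_functional D" "f (x - c0) = minkowski_functional D (x - c0)"
    using Hahn_Banach_sublinear[OF sublinear_minkowski_functional[OF \<open>convex D\<close> absorbing]] .
  have ge: "1 \<le> f (x - c0)"
    unfolding f(3) using one_le_minkowski_functional[OF \<open>convex D\<close> _ notin absorbing] UD U(2) by blast
  have fD: "f d \<le> 1" if "d \<in> D" for d
    using le_funD[OF f(2), of d] minkowski_functional_le[of 1 d D] that by simp
  have "continuous_on UNIV f"
  proof (rule linear_continuous_if_bounded_nhds[OF f(1)])
    \<comment> \<open>Membership in \<open>U\<close> bounds \<open>f\<close> only from above; the
      symmetric part of \<open>U\<close> bounds its absolute value.\<close>
    show "open (U \<inter> uminus -` U)"
      using U(1) by (intro open_Int open_vimage continuous_intros)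
    show "\<bar>f u\<bar> \<le> 1" if "u \<in> U \<inter> uminus -` U" for u
    proof -
      have "f u \<le> 1" "f (- u) \<le> 1"
        using that UD by (auto intro!: fD)
      then show ?thesis
        by (simp add: linear_neg[OF f(1)])
    qed
  qed (use U(2) in simp)
  then have "f \<in> continuous_functionals"
    using f(1) by (simp add: continuous_functionals_def)
  \<comment> \<open>The strict gap comes from the room left by \<open>U\<close>: the point
    \<open>(c - c0) + t *\<^sub>R (x - c0)\<close> is still in \<open>D\<close>, so
    \<open>f c\<close> stays below \<open>f x\<close> by at least
    \<open>t * f (x - c0)\<close>.\<close>
  moreover obtain t :: real where t: "t > 0" "t *\<^sub>R (x - c0) \<in> U"
    using tvs_open_absorbing[OF U(1,2)] by blast
  have "f c \<le> f x - t * f (x - c0)" if "c \<in> S" for c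
  proof -
    have "(c - c0) + t *\<^sub>R (x - c0) \<in> D"
      using that t(2) by (auto simp: D_def)
    then have "f ((c - c0) + t *\<^sub>R (x - c0)) \<le> 1"
      by (rule fD)
    then show ?thesis
      using ge by (simp add: linear_add[OF f(1)] linear_scale[OF f(1)] linear_diff[OF f(1)])
  qed
  moreover have "f x - t * f (x - c0) < f x"
    using t(1) ge by simp
  ultimately show thesis
    by (intro that[of f "f x - t * f (x - c0)"])
qed

section \<open>Generalized minimizers and sublevel sets\<close>

text \<open>This trades nets for closed sets, to which compactness applies. A minimizing net
  eventually enters both a given neighbourhood of \<open>x\<close> and a given sublevel set;
  conversely, points chosen in such intersections form a minimizing net.\<close>

lemma generalized_minimizers_eq:
  fixes g :: "'a::t2_space \<Rightarrow> ereal"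
  assumes m: "(INF y\<in>K. g y) = ereal m" and K: "closed K"
  shows "generalized_minimizers g K = (\<Inter>e\<in>{0<..}. closure {y\<in>K. g y < ereal (m + e)})"
proof (intro equalityI subsetI INT_I)
  fix x and e :: real
  assume x: "x \<in> generalized_minimizers g K" and "e \<in> {0<..}"
  from x obtain I :: "('a set \<times> ereal set) set" and r \<xi>
    where I: "directed_set I r" "\<xi> ` I \<subseteq> K" "(\<xi> \<longlongrightarrow> x) (net_filter I r)"
      "((\<lambda>i. g (\<xi> i)) \<longlongrightarrow> ereal m) (net_filter I r)"
    unfolding generalized_minimizers_def m by blast
  show "x \<in> closure {y\<in>K. g y < ereal (m + e)}"
    unfolding closure_iff_nhds_not_empty
  proof (intro allI impI)
    fix A V assume V: "V \<subseteq> A" "open V" "x \<in> V"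
    have "\<forall>\<^sub>F i in net_filter I r. \<xi> i \<in> V"
      using I(3) V by (auto dest: topological_tendstoD)
    moreover have "\<forall>\<^sub>F i in net_filter I r. g (\<xi> i) < ereal (m + e)"
      using I(4) \<open>e \<in> {0<..}\<close> by (auto intro: order_tendstoD)
    ultimately have "\<forall>\<^sub>F i in net_filter I r. \<xi> i \<in> V \<and> g (\<xi> i) < ereal (m + e)"
      by (rule eventually_conj)
    then obtain i where "i \<in> I" "\<forall>j\<in>I. r i j \<longrightarrow> \<xi> j \<in> V \<and> g (\<xi> j) < ereal (m + e)"
      unfolding eventually_net_filter[OF I(1)] by blast
    moreover have "r i i"
      using I(1) \<open>i \<in> I\<close> by (simp add: directed_set_def)
    ultimately show "{y\<in>K. g y < ereal (m + e)} \<inter> A \<noteq> {}"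
      using I(2) V(1) by blast
  qed
next
  fix x assume x: "x \<in> (\<Inter>e\<in>{0<..}. closure {y\<in>K. g y < ereal (m + e)})"
  \<comment> \<open>The net is indexed by a neighbourhood and a tolerance, both shrinking. This
    index type differs from the one in the definition; \<open>generalized_minimizersI\<close>
    bridges the difference.\<close>
  define J where "J = {(U, e::real). open U \<and> x \<in> U \<and> e > 0}"
  define s :: "'a set \<times> real \<Rightarrow> 'a set \<times> real \<Rightarrow> bool"
    where "s p q \<longleftrightarrow> fst q \<subseteq> fst p \<and> snd q \<le> snd p" for p q
  have "\<exists>y. y \<in> K \<and> y \<in> fst p \<and> g y < ereal (m + snd p)" if "p \<in> J" for p
  proof -
    have p: "open (fst p)" "x \<in> fst p" "snd p > 0"
      using that by (auto simp: J_def)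
    with x have "x \<in> closure {y\<in>K. g y < ereal (m + snd p)}"
      by auto
    then have "{y\<in>K. g y < ereal (m + snd p)} \<inter> fst p \<noteq> {}"
      using p unfolding closure_iff_nhds_not_empty by blast
    then show ?thesis
      by blast
  qed
  then obtain \<eta> where \<eta>: "\<And>p. p \<in> J \<Longrightarrow> \<eta> p \<in> K \<and> \<eta> p \<in> fst p \<and> g (\<eta> p) < ereal (m + snd p)"
    by metis
  show "x \<in> generalized_minimizers g K"
  proof (rule generalized_minimizersI)
    show J: "directed_set J s"
      unfolding directed_set_def
    proof (intro conjI ballI impI)
      show "J \<noteq> {}"
        unfolding J_def by (auto intro!: exI[of _ UNIV] exI[of _ 1])
      fix p q assume "p \<in> J" "q \<in> J"
      then show "\<exists>k\<in>J. s p k \<and> s q k"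
        by (intro bexI[of _ "(fst p \<inter> fst q, min (snd p) (snd q))"]) (auto simp: J_def s_def)
    qed (auto simp: s_def)
    show "x \<in> K"
    proof -
      have "x \<in> closure {y\<in>K. g y < ereal (m + 1)}"
        using x by auto
      also have "\<dots> \<subseteq> K"
        by (rule closure_minimal) (use K in auto)
      finally show ?thesis .
    qed
    show "\<eta> ` J \<subseteq> K"
      using \<eta> by blast
    show "(\<eta> \<longlongrightarrow> x) (net_filter J s)"
      unfolding tendsto_def eventually_net_filter[OF J]
    proof (intro allI impI)
      fix U assume "open U" "x \<in> U"
      then show "\<exists>i\<in>J. \<forall>j\<in>J. s i j \<longrightarrow> \<eta> j \<in> U"
        using \<eta> by (intro bexI[of _ "(U, 1)"]) (force simp: J_def s_def)+
    qed
    show "((\<lambda>j. g (\<eta> j)) \<longlongrightarrow> (INF y\<in>K. g y)) (net_filter J s)"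
      unfolding m
    proof (rule order_tendstoI)
      fix a assume a: "a < ereal m"
      have "a < g (\<eta> j)" if "j \<in> J" for j
        using a INF_lower[of "\<eta> j" K g] \<eta>[OF that] m by (simp add: less_le_trans)
      moreover have "J \<noteq> {}"
        using J by (simp add: directed_set_def)
      ultimately show "\<forall>\<^sub>F j in net_filter J s. a < g (\<eta> j)"
        unfolding eventually_net_filter[OF J] by blast
    next
      fix a assume "ereal m < a"
      \<comment> \<open>A real \<open>b\<close> is needed since \<open>a\<close> may be infinite;
        \<open>b - m\<close> is then a legitimate tolerance.\<close>
      then obtain b where b: "ereal m < ereal b" "ereal b < a"
        using ereal_dense2 by blast
      have "g (\<eta> j) < a" if "j \<in> J" "s (UNIV, b - m) j" for j
      proof -
        have "g (\<eta> j) < ereal (m + snd j)"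
          using \<eta>[OF that(1)] by blast
        also have "\<dots> \<le> ereal b"
          using that(2) by (simp add: s_def)
        also have "\<dots> < a"
          by (rule b)
        finally show ?thesis .
      qed
      moreover have "(UNIV, b - m) \<in> J"
        using b(1) by (simp add: J_def)
      ultimately show "\<forall>\<^sub>F j in net_filter J s. g (\<eta> j) < a"
        unfolding eventually_net_filter[OF J] by blast
    qed
  qed
qed

text \<open>The complements of the closed sublevel sets cover the compact set \<open>K - W\<close>.
  Finitely many suffice, and since sublevel sets are nested the smallest tolerance serves for
  all.\<close>

lemma sublevel_subset_if_generalized_minimizers_subset:
  fixes g :: "'a::t2_space \<Rightarrow> ereal"
  assumes m: "(INF y\<in>K. g y) = ereal m" and K: "compact K"
    and W: "open W" "generalized_minimizers g K \<subseteq> W"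
  obtains e where "e > 0" "{y\<in>K. g y < ereal (m + e)} \<subseteq> W"
proof -
  let ?A = "\<lambda>e. {y\<in>K. g y < ereal (m + e)}"
  have "K - W \<subseteq> (\<Union>e\<in>{0<..}. - closure (?A e))"
    using W(2) unfolding generalized_minimizers_eq[OF m compact_imp_closed[OF K]] by blast
  then obtain E where E: "E \<subseteq> {0<..}" "finite E" "K - W \<subseteq> (\<Union>e\<in>E. - closure (?A e))"
    by (rule compactE_image[OF compact_diff[OF K W(1)], rotated]) auto
  \<comment> \<open>Inserting 1 keeps the minimum meaningful when \<open>E\<close> is empty.\<close>
  define e where "e = Min (insert 1 E)"
  have "e > 0"
    using E(1,2) by (auto simp: e_def)
  moreover have "y \<in> W" if y: "y \<in> ?A e" for y
  proof (rule ccontr)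
    assume "y \<notin> W"
    then obtain d where d: "d \<in> E" "y \<notin> closure (?A d)"
      using E(3) y by blast
    have "e \<le> d"
      using d(1) E(2) by (auto simp: e_def)
    then have "g y < ereal (m + d)"
      using y by (auto elim!: less_le_trans)
    then show False
      using y d(2) closure_subset[of "?A d"] by blast
  qed
  ultimately show thesis
    by (intro that) blast+
qed

text \<open>Otherwise the empty set would be an admissible \<open>W\<close>, leaving a sublevel set
  above the infimum empty.\<close>

lemma generalized_minimizers_nonempty:
  fixes g :: "'a::t2_space \<Rightarrow> ereal"
  assumes m: "(INF y\<in>K. g y) = ereal m" and K: "compact K"
  shows "generalized_minimizers g K \<noteq> {}"
proof
  assume "generalized_minimizers g K = {}"
  then obtain e where e: "e > 0" "{y\<in>K. g y < ereal (m + e)} \<subseteq> {}"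
    using sublevel_subset_if_generalized_minimizers_subset[OF m K, of "{}"] by auto
  have "(INF y\<in>K. g y) < ereal (m + e)"
    using m e(1) by simp
  then show False
    using e(2) by (auto simp: INF_less_iff)
qed

section \<open>Subgradients of the Legendre-Fenchel transform\<close>

text \<open>The base point \<open>f\<close> is absorbed into \<open>g\<close>: the transform at
  \<open>f + f'\<close> is the supremum of \<open>f' - g\<close>, which for \<open>f' = 0\<close>
  equals \<open>- m\<close>.\<close>

lemma predual_subdifferential_legendre_fenchel_iff:
  fixes K :: "'a::topological_real_vector set" and f :: "'a weak_star_dual" and h :: "'a \<Rightarrow> ereal"
  defines "g \<equiv> \<lambda>y. h y - ereal (dual_apply f y)"
  assumes m: "(INF y\<in>K. g y) = ereal m"
  shows "x \<in> predual_subdifferential (legendre_fenchel K h) f \<longleftrightarrow>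
    (\<forall>f'. ereal (dual_apply f' x - m) \<le> (SUP y\<in>K. ereal (dual_apply f' y) - g y))"
proof -
  have shift: "legendre_fenchel K h (f + f') = (SUP y\<in>K. ereal (dual_apply f' y) - g y)" for f'
  proof -
    have "ereal (dual_apply (f + f') y) - h y = ereal (dual_apply f' y) - g y" for y
      by (cases "h y") (auto simp: g_def)
    then show ?thesis
      by (simp add: legendre_fenchel_def)
  qed
  have "legendre_fenchel K h f = (SUP y\<in>K. - g y)"
    using shift[of 0] by (simp add: zero_ereal_def[symmetric])
  also have "\<dots> = ereal (- m)"
    unfolding ereal_SUP_uminus_eq m by simp
  finally show ?thesis
    by (simp add: mem_predual_subdifferential_iff shift)
qed

theorem predual_subdifferential_eq_closure_convex_hull:
  fixes K :: "'a::locally_convex_real_space set" and f :: "'a weak_star_dual" and h :: "'a \<Rightarrow> ereal"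
  defines "g \<equiv> \<lambda>y. h y - ereal (dual_apply f y)"
  assumes K: "compact K" and m: "(INF y\<in>K. g y) = ereal m"
  defines "P \<equiv> predual_subdifferential (legendre_fenchel K h) f"
  shows "convex P" "P = closure (convex hull (generalized_minimizers g K))"
proof -
  have memP: "x \<in> P \<longleftrightarrow>
      (\<forall>u. ereal (dual_apply u x - m) \<le> (SUP y\<in>K. ereal (dual_apply u y) - g y))" for x
    using predual_subdifferential_legendre_fenchel_iff[OF m[unfolded g_def]]
    by (simp add: P_def g_def)
  have cont: "continuous_on UNIV (dual_apply u)" and lin: "linear (dual_apply u)"
    for u :: "'a weak_star_dual"
    using dual_apply[of u] by (auto simp: continuous_functionals_def)
  \<comment> \<open>Moving the finite \<open>m\<close> to the right turns each condition into an
    upper bound on \<open>dual_apply u x\<close>; an infinite bound gives the whole space or the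
    empty set.\<close>
  define \<phi> where "\<phi> u = (SUP y\<in>K. ereal (dual_apply u y) - g y) + ereal m" for u
  have P_eq: "P = (\<Inter>u. {x. ereal (dual_apply u x) \<le> \<phi> u})"
  proof -
    have "ereal (a - m) \<le> b \<longleftrightarrow> ereal a \<le> b + ereal m" for a b
      by (cases b) (auto simp: algebra_simps)
    then show ?thesis
      by (auto simp: memP \<phi>_def)
  qed
  have half: "convex {x. ereal (dual_apply u x) \<le> b} \<and> closed {x. ereal (dual_apply u x) \<le> b}"
    for u :: "'a weak_star_dual" and b
  proof (cases b)
    case (real c)
    have "{x. ereal (dual_apply u x) \<le> b} = dual_apply u -` {..c}"
      by (auto simp: real)
    then show ?thesis
      using convex_linear_vimage[OF lin] closed_vimage[OF _ cont] by simp
  qed auto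
  show "convex P"
    unfolding P_eq using half by (intro convex_INT) auto
  have "closed P"
    unfolding P_eq using half by (intro closed_INT) auto
  have "generalized_minimizers g K \<subseteq> P"
  proof
    fix x assume x: "x \<in> generalized_minimizers g K"
    show "x \<in> P"
      unfolding memP
    proof (rule allI, rule ereal_le_epsilon2)
      fix u :: "'a weak_star_dual" and e :: real assume "e > 0"
      \<comment> \<open>Half of \<open>e\<close> pays for the variation of \<open>u\<close> near
        \<open>x\<close>, the other half for the excess of \<open>g\<close> over
        \<open>m\<close>.\<close>
      define V where "V = dual_apply u -` {dual_apply u x - e / 2 <..}"
      have "open V" "x \<in> V"
        unfolding V_def using cont \<open>e > 0\<close> by (auto intro: open_vimage)
      moreover have "x \<in> closure {y\<in>K. g y < ereal (m + e / 2)}"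
        using x \<open>e > 0\<close> unfolding generalized_minimizers_eq[OF m compact_imp_closed[OF K]] by simp
      ultimately obtain y where y: "y \<in> K" "y \<in> V" "g y < ereal (m + e / 2)"
        unfolding closure_iff_nhds_not_empty by blast
      have "ereal (dual_apply u x - m) \<le> (ereal (dual_apply u y) - g y) + ereal e"
        using y INF_lower[of y K g] m by (cases "g y") (auto simp: V_def)
      also have "\<dots> \<le> (SUP y\<in>K. ereal (dual_apply u y) - g y) + ereal e"
        using y(1) by (intro add_right_mono SUP_upper)
      finally show "ereal (dual_apply u x - m)
          \<le> (SUP y\<in>K. ereal (dual_apply u y) - g y) + ereal e" .
    qed
  qed
  then have "closure (convex hull (generalized_minimizers g K)) \<subseteq> P"
    using \<open>convex P\<close> \<open>closed P\<close> by (intro closure_minimal hull_minimal) auto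
  moreover have "x \<in> closure (convex hull (generalized_minimizers g K))" if "x \<in> P" for x
  proof (rule ccontr)
    assume "x \<notin> closure (convex hull (generalized_minimizers g K))"
    then obtain l s where l: "l \<in> continuous_functionals" "s < l x"
      "\<And>c. c \<in> convex hull (generalized_minimizers g K) \<Longrightarrow> l c \<le> s"
      using Hahn_Banach_separation[OF convex_convex_hull] by blast
    obtain u where u: "dual_apply u = l"
      using Abs_weak_star_dual_inverse[OF l(1)] by blast
    \<comment> \<open>The hull satisfies only \<open>l c \<le> s\<close>; the intermediate
      \<open>s'\<close> gives an open half-space around the minimizers that still excludes
      \<open>x\<close>.\<close>
    obtain s' where s': "s < s'" "s' < l x"
      using dense[OF l(2)] by blast
    have "open (l -` {..<s'})"
      using cont[of u] u by (auto intro: open_vimage)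
    moreover have "generalized_minimizers g K \<subseteq> l -` {..<s'}"
      using l(3) hull_subset[of _ convex] s'(1) by fastforce
    ultimately obtain e where e: "e > 0" "{y\<in>K. g y < ereal (m + e)} \<subseteq> l -` {..<s'}"
      by (rule sublevel_subset_if_generalized_minimizers_subset[OF m K])
    have "bounded (l ` K)"
      using compact_continuous_image[OF continuous_on_subset[OF cont[of u]] K] u
      by (auto intro: compact_imp_bounded)
    then obtain B where B: "\<And>y. y \<in> K \<Longrightarrow> \<bar>l y\<bar> \<le> B"
      by (auto simp: bounded_iff)
    \<comment> \<open>Chosen so that \<open>t * (l y - s')\<close> never exceeds \<open>e\<close> on
      \<open>K\<close>; the summand 1 keeps the denominator positive.\<close>
    define t where "t = e / (\<bar>B\<bar> + \<bar>s'\<bar> + 1)"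
    have t: "t > 0" "t * (\<bar>B\<bar> + \<bar>s'\<bar> + 1) = e"
      using e(1) by (auto simp: t_def)
    \<comment> \<open>In the sublevel set \<open>l y < s'\<close> and \<open>g y \<ge> m\<close>.
      Outside it, \<open>l y\<close> may exceed \<open>s'\<close>, but the excess is at most
      \<open>e\<close> after scaling and is offset by \<open>g y \<ge> m + e\<close>.\<close>
    have "ereal (t * l y) - g y \<le> ereal (t * s' - m)" if y: "y \<in> K" for y
    proof (cases "g y < ereal (m + e)")
      case True
      then have "t * l y \<le> t * s'"
        using e(2) y t(1) by (intro mult_left_mono) auto
      then show ?thesis
        using True INF_lower[OF y, of g] m by (cases "g y") auto
    next
      case False
      have "t * (l y - s') \<le> t * (\<bar>B\<bar> + \<bar>s'\<bar> + 1)"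
        using B[OF y] t(1) by (intro mult_left_mono) auto
      then have "t * l y \<le> t * s' + e"
        using t(2) by (simp add: algebra_simps)
      then show ?thesis
        using False by (cases "g y") auto
    qed
    then have "(SUP y\<in>K. ereal (dual_apply (t *\<^sub>R u) y) - g y) \<le> ereal (t * s' - m)"
      by (intro SUP_least) (simp add: u)
    moreover have "ereal (dual_apply (t *\<^sub>R u) x - m)
        \<le> (SUP y\<in>K. ereal (dual_apply (t *\<^sub>R u) y) - g y)"
      using \<open>x \<in> P\<close> unfolding memP by blast
    ultimately have "ereal (dual_apply (t *\<^sub>R u) x - m) \<le> ereal (t * s' - m)"
      by (rule order_trans[rotated])
    then show False
      using t(1) s'(2) by (simp add: u)
  qed
  ultimately show "P = closure (convex hull (generalized_minimizers g K))"
    by blast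
qed

text \<open>Compactness bounds the functional by some \<open>B\<close> on \<open>K\<close>, so the
  difference is at least \<open>k - B\<close>; a point where \<open>h\<close> is not infinite keeps
  the infimum below infinity.\<close>

lemma INF_diff_dual_finite:
  fixes K :: "'a::topological_real_vector set" and f :: "'a weak_star_dual"
  assumes "compact K" and k: "\<forall>x\<in>K. ereal k \<le> h x" and "\<exists>x\<in>K. h x \<noteq> \<infinity>"
  obtains m where "(INF y\<in>K. h y - ereal (dual_apply f y)) = ereal m"
proof -
  let ?g = "\<lambda>y. h y - ereal (dual_apply f y)"
  have "continuous_on K (dual_apply f)"
    using dual_apply[of f] continuous_on_subset by (auto simp: continuous_functionals_def)
  then have "bounded (dual_apply f ` K)"
    using assms(1) by (intro compact_imp_bounded compact_continuous_image)
  then obtain B where B: "\<And>y. y \<in> K \<Longrightarrow> \<bar>dual_apply f y\<bar> \<le> B"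
    by (auto simp: bounded_iff)
  have "ereal (k - B) \<le> ?g y" if "y \<in> K" for y
    using k that B[OF that] by (cases "h y") force+
  then have "ereal (k - B) \<le> (INF y\<in>K. ?g y)"
    by (intro INF_greatest)
  moreover obtain x where x: "x \<in> K" "h x \<noteq> \<infinity>"
    using assms(3) by blast
  then have "?g x \<noteq> \<infinity>"
    by (cases "h x") auto
  then have "(INF y\<in>K. ?g y) \<noteq> \<infinity>"
    using INF_lower[OF x(1), of ?g] by auto
  ultimately show thesis
    by (cases "INF y\<in>K. ?g y") (auto intro: that)
qed

theorem theorem1p8:
  fixes K :: "'a::locally_convex_real_space set"
    and h :: "'a \<Rightarrow> ereal"
    and k :: real
  assumes "K \<noteq> {}" and "compact K" and "convex K"
    and "\<forall>x\<in>K. ereal k \<le> h x"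
    and "\<exists>x\<in>K. h x \<noteq> \<infinity>"
  shows "\<forall>f :: 'a weak_star_dual.
    predual_subdifferential (legendre_fenchel K h) f \<noteq> {} \<and>
    compact (predual_subdifferential (legendre_fenchel K h) f) \<and>
    convex (predual_subdifferential (legendre_fenchel K h) f) \<and>
    predual_subdifferential (legendre_fenchel K h) f =
      closure (convex hull (generalized_minimizers (\<lambda>x. h x - ereal (dual_apply f x)) K))"
proof
  fix f :: "'a weak_star_dual"
  let ?g = "\<lambda>x. h x - ereal (dual_apply f x)"
  let ?C = "closure (convex hull (generalized_minimizers ?g K))"
  obtain m where m: "(INF y\<in>K. ?g y) = ereal m"
    using INF_diff_dual_finite[OF assms(2,4,5)] .
  have "generalized_minimizers ?g K \<subseteq> ?C"
    using hull_subset closure_subset by (rule order_trans)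
  then have "?C \<noteq> {}"
    using generalized_minimizers_nonempty[OF m assms(2)] by (metis subset_empty)
  \<comment> \<open>Since \<open>K\<close> is convex and closed, it contains the closed convex hull
    as well, which is therefore a closed subset of a compact set.\<close>
  moreover have "generalized_minimizers ?g K \<subseteq> K"
    unfolding generalized_minimizers_def by (rule Collect_restrict)
  then have "?C \<subseteq> K"
    using assms(3) compact_imp_closed[OF assms(2)] by (intro closure_minimal hull_minimal)
  then have "compact ?C"
    using compact_Int_closed[OF assms(2) closed_closure, of "convex hull (generalized_minimizers ?g K)"]
    by (simp add: Int_absorb1)
  ultimately show "predual_subdifferential (legendre_fenchel K h) f \<noteq> {} \<and>
    compact (predual_subdifferential (legendre_fenchel K h) f) \<and>
    convex (predual_subdifferential (legendre_fenchel K h) f) \<and>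
    predual_subdifferential (legendre_fenchel K h) f = ?C"
    using predual_subdifferential_eq_closure_convex_hull[OF assms(2) m] by simp
qed

end
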